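(* Let $X$ be the Dynkin diagram of a symmetrizable generalized Cartan matrix $A=(a_{ij})$ with simple roots $\alpha_i$ ($i\in X$). Suppose $I$ is a subset of the vertices of $X$ which forms a connected subdiagram of finite type. Let $\beta_\bullet=\sum_{i\in I}\alpha_i$. Then $\{\beta_\bullet\}\cup\{\alpha_j : j\in X\setminus I\}$ is a $\pi$-system in $X$. Its type $B$, a generalized Cartan matrix with rows and columns indexed by $\{\bullet\}\cup (X\setminus I)$, satisfies $b_{jk}=a_{jk}$ for $j,k\in X\setminus I$, and for every $j\in X\setminus I$, $$b_{j\bullet}=\sum_{i\in I}a_{ji},\qquad b_{\bullet j}=\sum_{i\in I}k_i\,a_{ij},\qquad\text{where } k_i=\frac{|\alpha_i|^2}{|\beta_\bullet|^2}.$$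
   Context: A $\pi$-system in $X$ is a finite set of distinct real roots $\{\beta_i\}$ of the Kac-Moody algebra of $X$ such that $\beta_i-\beta_j$ is not a root for any $i\ne j$. Its type is the matrix $B=(b_{ij})$ with $b_{ij}=\langle\beta_i^\vee,\beta_j\rangle=2(\beta_i|\beta_j)/(\beta_i|\beta_i)$, where $\beta^\vee$ is the coroot of the real root $\beta$, $(\cdot|\cdot)$ is a standard invariant form (so $a_{ij}=2(\alpha_i|\alpha_j)/(\alpha_i|\alpha_i)$), and $|\alpha|^2=(\alpha|\alpha)$. *)

theory Defs
  imports "HOL-Analysis.Analysis" "HOL-Library.Function_Algebras" "HOL-Library.Nonpos_Ints"
begin

section \<open>Generalized Cartan matrices and their diagrams\<close>

definition generalized_cartan_matrix :: "'k set \<Rightarrow> ('k \<Rightarrow> 'k \<Rightarrow> 'r::ring_1) \<Rightarrow> bool" where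
  "generalized_cartan_matrix K A \<longleftrightarrow>
     finite K \<and>
     (\<forall>i\<in>K. A i i = 2) \<and>
     (\<forall>i\<in>K. \<forall>j\<in>K. i \<noteq> j \<longrightarrow> A i j \<in> \<int>\<^sub>\<le>\<^sub>0) \<and>
     (\<forall>i\<in>K. \<forall>j\<in>K. A i j = 0 \<longrightarrow> A j i = 0)"

definition symmetrizable :: "('i \<Rightarrow> 'i \<Rightarrow> int) \<Rightarrow> bool" where
  "symmetrizable A \<longleftrightarrow>
     (\<exists>(d :: 'i \<Rightarrow> real) S. (\<forall>i. d i \<noteq> 0) \<and> (\<forall>i j. S i j = S j i) \<and>
        (\<forall>i j. of_int (A i j) = d i * S i j))"

text \<open>The subdiagram on the vertex set \<open>I\<close>; connected subdiagrams are nonempty.\<close>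

definition connected_subdiagram :: "('i \<Rightarrow> 'i \<Rightarrow> int) \<Rightarrow> 'i set \<Rightarrow> bool" where
  "connected_subdiagram A I \<longleftrightarrow>
     I \<noteq> {} \<and>
     (\<forall>i\<in>I. \<forall>j\<in>I. (i, j) \<in> {(k, l). k \<in> I \<and> l \<in> I \<and> k \<noteq> l \<and> A k l \<noteq> 0}\<^sup>*)"

text \<open>
  Kac, \<open>Infinite dimensional Lie algebras\<close>, Theorem 4.3, case (Fin), for the principal submatrix
  on \<open>I\<close>: the determinant is nonzero (stated as triviality of the kernel), some \<open>u > 0\<close> has
  \<open>A u > 0\<close>, and \<open>A v \<ge> 0\<close> implies \<open>v > 0\<close> or \<open>v = 0\<close>.
\<close>

definition finite_type :: "('i \<Rightarrow> 'i \<Rightarrow> int) \<Rightarrow> 'i set \<Rightarrow> bool" where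
  "finite_type A I \<longleftrightarrow>
     (\<forall>v :: 'i \<Rightarrow> real. (\<forall>i\<in>I. (\<Sum>j\<in>I. of_int (A i j) * v j) = 0) \<longrightarrow> (\<forall>j\<in>I. v j = 0)) \<and>
     (\<exists>u :: 'i \<Rightarrow> real. (\<forall>j\<in>I. u j > 0) \<and> (\<forall>i\<in>I. (\<Sum>j\<in>I. of_int (A i j) * u j) > 0)) \<and>
     (\<forall>v :: 'i \<Rightarrow> real. (\<forall>i\<in>I. (\<Sum>j\<in>I. of_int (A i j) * v j) \<ge> 0) \<longrightarrow>
        (\<forall>j\<in>I. v j > 0) \<or> (\<forall>j\<in>I. v j = 0))"

section \<open>Lie algebras\<close>

locale lie_algebra = vector_space scale
  for scale :: "complex \<Rightarrow> 'g::ab_group_add \<Rightarrow> 'g" +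
  fixes br :: "'g \<Rightarrow> 'g \<Rightarrow> 'g"
  assumes linear_left: "Vector_Spaces.linear scale scale (\<lambda>x. br x y)"
    and linear_right: "Vector_Spaces.linear scale scale (\<lambda>y. br x y)"
    and alternating: "br x x = 0"
    and jacobi: "br x (br y z) + br y (br z x) + br z (br x y) = 0"

definition lie_subalgebra ::
  "(complex \<Rightarrow> 'g::ab_group_add \<Rightarrow> 'g) \<Rightarrow> ('g \<Rightarrow> 'g \<Rightarrow> 'g) \<Rightarrow> 'g set \<Rightarrow> bool" where
  "lie_subalgebra sc br S \<longleftrightarrow> module.subspace sc S \<and> (\<forall>x\<in>S. \<forall>y\<in>S. br x y \<in> S)"

definition lie_ideal ::
  "(complex \<Rightarrow> 'g::ab_group_add \<Rightarrow> 'g) \<Rightarrow> ('g \<Rightarrow> 'g \<Rightarrow> 'g) \<Rightarrow> 'g set \<Rightarrow> bool" where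
  "lie_ideal sc br J \<longleftrightarrow> module.subspace sc J \<and> (\<forall>x. \<forall>y\<in>J. br x y \<in> J)"

section \<open>Kac--Moody algebras\<close>

text \<open>
  The Cartan subalgebra is a type \<open>'h\<close> of its own, embedded into the Lie algebra \<open>'g\<close> by
  \<open>incl\<close>. Its dual is the set of linear functions \<open>'h \<Rightarrow> complex\<close>, with the pointwise
  operations. Simple roots and coroots are indexed by the vertices \<open>'i\<close> of the diagram.
\<close>

record ('i, 'h, 'g) kac_moody_data =
  hscale :: "complex \<Rightarrow> 'h \<Rightarrow> 'h"
  gscale :: "complex \<Rightarrow> 'g \<Rightarrow> 'g"
  bracket :: "'g \<Rightarrow> 'g \<Rightarrow> 'g"
  incl :: "'h \<Rightarrow> 'g"
  simple_root :: "'i \<Rightarrow> 'h \<Rightarrow> complex"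
  simple_coroot :: "'i \<Rightarrow> 'h"
  chevalley_e :: "'i \<Rightarrow> 'g"
  chevalley_f :: "'i \<Rightarrow> 'g"

definition dual_scale :: "complex \<Rightarrow> ('h \<Rightarrow> complex) \<Rightarrow> 'h \<Rightarrow> complex" where
  "dual_scale c \<mu> = (\<lambda>h. c * \<mu> h)"

definition dual_space :: "('i, 'h::ab_group_add, 'g::ab_group_add) kac_moody_data \<Rightarrow> ('h \<Rightarrow> complex) set" where
  "dual_space G = {\<mu>. Vector_Spaces.linear (hscale G) (*) \<mu>}"

text \<open>
  A realization of \<open>A\<close>: \<open>dim h = 2 n - rank A\<close>. As \<open>n > 0\<close> this makes \<open>h\<close> finite-dimensional,
  since the library assigns dimension 0 to infinite-dimensional spaces.
\<close>

definition realization ::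
  "('i::finite \<Rightarrow> 'i \<Rightarrow> int) \<Rightarrow> ('i, 'h::ab_group_add, 'g::ab_group_add) kac_moody_data \<Rightarrow> bool" where
  "realization A G \<longleftrightarrow>
     vector_space (hscale G) \<and>
     range (simple_root G) \<subseteq> dual_space G \<and>
     inj (simple_root G) \<and> \<not> module.dependent dual_scale (range (simple_root G)) \<and>
     inj (simple_coroot G) \<and> \<not> module.dependent (hscale G) (range (simple_coroot G)) \<and>
     (\<forall>i j. simple_root G j (simple_coroot G i) = of_int (A i j)) \<and>
     vector_space.dim (hscale G) (UNIV :: 'h set)
       = 2 * CARD('i) - rank (\<chi> i j. real_of_int (A i j))"

text \<open>
  The Kac--Moody algebra \<open>g(A)\<close> is the Lie algebra generated by \<open>h\<close>, \<open>e\<^sub>i\<close>, \<open>f\<^sub>i\<close> subject to the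
  relations below, modulo the largest ideal meeting \<open>h\<close> trivially. The predicate says that \<open>G\<close> is
  such an algebra together with its Chevalley generators; it determines \<open>G\<close> up to isomorphism
  (Kac, Proposition 1.4).
\<close>

definition kac_moody_algebra ::
  "('i::finite \<Rightarrow> 'i \<Rightarrow> int) \<Rightarrow> ('i, 'h::ab_group_add, 'g::ab_group_add) kac_moody_data \<Rightarrow> bool" where
  "kac_moody_algebra A G \<longleftrightarrow>
     generalized_cartan_matrix UNIV A \<and>
     realization A G \<and>
     lie_algebra (gscale G) (bracket G) \<and>
     Vector_Spaces.linear (hscale G) (gscale G) (incl G) \<and> inj (incl G) \<and>
     (\<forall>h h'. bracket G (incl G h) (incl G h') = 0) \<and>
     (\<forall>h i. bracket G (incl G h) (chevalley_e G i)
              = gscale G (simple_root G i h) (chevalley_e G i)) \<and>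
     (\<forall>h i. bracket G (incl G h) (chevalley_f G i)
              = gscale G (- simple_root G i h) (chevalley_f G i)) \<and>
     (\<forall>i j. bracket G (chevalley_e G i) (chevalley_f G j)
              = (if i = j then incl G (simple_coroot G i) else 0)) \<and>
     (\<forall>S. lie_subalgebra (gscale G) (bracket G) S \<and>
          range (incl G) \<union> range (chevalley_e G) \<union> range (chevalley_f G) \<subseteq> S \<longrightarrow> S = UNIV) \<and>
     (\<forall>J. lie_ideal (gscale G) (bracket G) J \<and> J \<inter> range (incl G) = {0} \<longrightarrow> J = {0})"

section \<open>Roots\<close>

definition root_space ::
  "('i, 'h::ab_group_add, 'g::ab_group_add) kac_moody_data \<Rightarrow> ('h \<Rightarrow> complex) \<Rightarrow> 'g set" where
  "root_space G \<mu> = {x. \<forall>h. bracket G (incl G h) x = gscale G (\<mu> h) x}"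

definition is_root ::
  "('i, 'h::ab_group_add, 'g::ab_group_add) kac_moody_data \<Rightarrow> ('h \<Rightarrow> complex) \<Rightarrow> bool" where
  "is_root G \<mu> \<longleftrightarrow> \<mu> \<in> dual_space G \<and> \<mu> \<noteq> 0 \<and> root_space G \<mu> \<noteq> {0}"

definition reflection ::
  "('i, 'h::ab_group_add, 'g::ab_group_add) kac_moody_data \<Rightarrow> 'i \<Rightarrow> ('h \<Rightarrow> complex) \<Rightarrow> ('h \<Rightarrow> complex)" where
  "reflection G i \<mu> = \<mu> - dual_scale (\<mu> (simple_coroot G i)) (simple_root G i)"

definition coreflection ::
  "('i, 'h::ab_group_add, 'g::ab_group_add) kac_moody_data \<Rightarrow> 'i \<Rightarrow> 'h \<Rightarrow> 'h" where
  "coreflection G i h = h - hscale G (simple_root G i h) (simple_coroot G i)"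

text \<open>
  An element \<open>s\<^sub>i\<^sub>1 \<dots> s\<^sub>i\<^sub>k\<close> of the Weyl group is given by a word \<open>[i\<^sub>1, \<dots>, i\<^sub>k]\<close>. It acts on the dual
  of \<open>h\<close> by \<open>foldr (reflection G)\<close>, and contragrediently on \<open>h\<close> by \<open>foldr (coreflection G)\<close>.
\<close>

definition real_root ::
  "('i, 'h::ab_group_add, 'g::ab_group_add) kac_moody_data \<Rightarrow> ('h \<Rightarrow> complex) \<Rightarrow> bool" where
  "real_root G \<beta> \<longleftrightarrow>
     is_root G \<beta> \<and> (\<exists>w i. \<beta> = foldr (reflection G) w (simple_root G i))"

text \<open>The coroot of \<open>\<beta> = w \<alpha>\<^sub>i\<close> is \<open>w \<alpha>\<^sub>i\<^sup>\<or>\<close>, which depends on \<open>\<beta>\<close> only.\<close>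

definition coroot ::
  "('i, 'h::ab_group_add, 'g::ab_group_add) kac_moody_data \<Rightarrow> ('h \<Rightarrow> complex) \<Rightarrow> 'h" where
  "coroot G \<beta> =
     (THE c. \<exists>w i. \<beta> = foldr (reflection G) w (simple_root G i) \<and>
                   c = foldr (coreflection G) w (simple_coroot G i))"

section \<open>Standard invariant forms\<close>

text \<open>
  A standard invariant form (Kac, Sections 2.1--2.3) is an invariant symmetric bilinear form on
  the Lie algebra, nondegenerate on \<open>h\<close>, with \<open>(\<alpha>\<^sub>i\<^sup>\<or>|h) = \<epsilon>\<^sub>i \<langle>\<alpha>\<^sub>i, h\<rangle>\<close> for some \<open>\<epsilon>\<^sub>i > 0\<close>.
  No normalization on a complement of the span of the simple coroots in \<open>h\<close> is imposed.
\<close>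

definition standard_invariant_form ::
  "('i, 'h::ab_group_add, 'g::ab_group_add) kac_moody_data \<Rightarrow> ('g \<Rightarrow> 'g \<Rightarrow> complex) \<Rightarrow> bool" where
  "standard_invariant_form G B \<longleftrightarrow>
     (\<forall>x. Vector_Spaces.linear (gscale G) (*) (B x)) \<and>
     (\<forall>x y. B x y = B y x) \<and>
     (\<forall>x y z. B (bracket G x y) z = B x (bracket G y z)) \<and>
     (\<forall>h. (\<forall>h'. B (incl G h) (incl G h') = 0) \<longrightarrow> h = 0) \<and>
     (\<forall>i. \<exists>\<epsilon>::real. \<epsilon> > 0 \<and>
        (\<forall>h. B (incl G (simple_coroot G i)) (incl G h) = of_real \<epsilon> * simple_root G i h))"

text \<open>The form on the dual of \<open>h\<close> transported along \<open>h \<rightarrow> h\<^sup>*, t \<mapsto> (t|_)\<close>.\<close>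

definition form_dual ::
  "('i, 'h::ab_group_add, 'g::ab_group_add) kac_moody_data \<Rightarrow> ('g \<Rightarrow> 'g \<Rightarrow> complex)
     \<Rightarrow> ('h \<Rightarrow> complex) \<Rightarrow> 'h" where
  "form_dual G B \<mu> = (THE t. \<forall>h. B (incl G t) (incl G h) = \<mu> h)"

definition dual_form ::
  "('i, 'h::ab_group_add, 'g::ab_group_add) kac_moody_data \<Rightarrow> ('g \<Rightarrow> 'g \<Rightarrow> complex)
     \<Rightarrow> ('h \<Rightarrow> complex) \<Rightarrow> ('h \<Rightarrow> complex) \<Rightarrow> complex" where
  "dual_form G B \<mu> \<nu> = B (incl G (form_dual G B \<mu>)) (incl G (form_dual G B \<nu>))"

section \<open>\<open>\<pi>\<close>-systems\<close>

definition pi_system ::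
  "('i, 'h::ab_group_add, 'g::ab_group_add) kac_moody_data \<Rightarrow> 'k set \<Rightarrow> ('k \<Rightarrow> 'h \<Rightarrow> complex) \<Rightarrow> bool" where
  "pi_system G K \<beta> \<longleftrightarrow>
     finite K \<and> inj_on \<beta> K \<and> (\<forall>k\<in>K. real_root G (\<beta> k)) \<and>
     (\<forall>k\<in>K. \<forall>l\<in>K. k \<noteq> l \<longrightarrow> \<not> is_root G (\<beta> k - \<beta> l))"

definition pi_system_type ::
  "('i, 'h::ab_group_add, 'g::ab_group_add) kac_moody_data \<Rightarrow> ('k \<Rightarrow> 'h \<Rightarrow> complex) \<Rightarrow> 'k \<Rightarrow> 'k \<Rightarrow> complex" where
  "pi_system_type G \<beta> k l = \<beta> l (coroot G (\<beta> k))"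

text \<open>
  The index set \<open>{\<bullet>} \<union> (X - I)\<close>, with \<open>None\<close> in the role of \<open>\<bullet>\<close>, and the family of roots it indexes.
\<close>

definition collapsed_index :: "'i set \<Rightarrow> 'i option set" where
  "collapsed_index I = insert None (Some ` (- I))"

definition collapsed_roots ::
  "('i, 'h::ab_group_add, 'g::ab_group_add) kac_moody_data \<Rightarrow> 'i set \<Rightarrow> 'i option \<Rightarrow> 'h \<Rightarrow> complex" where
  "collapsed_roots G I k =
     (case k of None \<Rightarrow> \<Sum>i\<in>I. simple_root G i | Some j \<Rightarrow> simple_root G j)"

end

(*
  Write \<beta>_J for the sum of the simple roots \<alpha>_i, i \<in> J.  If J \<subseteq> I is connected, finite type gives
  a vertex j \<in> J at which \<beta>_J pairs positively with the coroot of \<alpha>_j.  Unless J = {j}, the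
  pairing is 1, j is a leaf of J, and \<beta>_J = s_j \<beta>_(J - {j}).  Removing leaves one by one shows
  that \<beta>_I is Weyl conjugate to a simple root.  Adding the leaves back builds a root vector: if
  x has weight \<beta>_(J - {j}), then [f_j, [e_j, x]] = x, so [e_j, x] is nonzero.

  The weights of the algebra are sums or negatives of sums of simple roots, hence the difference
  of two sums over disjoint nonempty sets of simple roots is not a root.

  If \<beta> = w \<alpha>_i and c = w \<alpha>_i^\<or>, then (c | h) = \<epsilon>_i \<beta>(h) and \<beta>(c) = 2.  These two facts
  determine c from \<beta>, give |\<beta>|^2 = 2 / \<epsilon>_i, and yield the entries of the type.
*)
theory Submission
  imports Defs
begin

section \<open>Leaves of diagrams of finite type\<close>

lemma nonpos_Ints_int_le: "(x::int) \<in> \<int>\<^sub>\<le>\<^sub>0 \<longleftrightarrow> x \<le> 0"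
  by (auto simp: nonpos_Ints_def)

text \<open>Entries of a row in \<open>J\<close> at columns outside \<open>J\<close> are
  nonpositive, so restricting to \<open>J\<close> keeps the row of \<open>A u\<close> positive. This
  supplies the leaf for the induction in \<open>real_root_sum\<close>.\<close>

lemma finite_type_row_sum_pos:
  fixes A :: "'i \<Rightarrow> 'i \<Rightarrow> int" and u :: "'i \<Rightarrow> real"
  assumes fin: "finite I" and J: "J \<subseteq> I" "J \<noteq> {}"
    and off: "\<And>i j. i \<noteq> j \<Longrightarrow> A i j \<le> 0"
    and u: "\<And>j. j \<in> I \<Longrightarrow> u j > 0"
    and Au: "\<And>i. i \<in> I \<Longrightarrow> (\<Sum>j\<in>I. of_int (A i j) * u j) > 0"
  shows "\<exists>j\<in>J. (\<Sum>k\<in>J. A j k) > 0"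
proof -
  have finJ: "finite J" using fin J finite_subset by blast
  \<comment> \<open>In the row where \<open>u\<close> is minimal, replacing \<open>u\<close> by a constant only increases the sum.\<close>
  obtain j where j: "j \<in> J" and min: "\<And>k. k \<in> J \<Longrightarrow> u j \<le> u k"
    using arg_min_if_finite[OF finJ J(2), of u] by (metis not_le_imp_less less_le_not_le)
  have "0 < (\<Sum>k\<in>I. of_int (A j k) * u k)" using Au j J by blast
  also have "\<dots> = (\<Sum>k\<in>J. of_int (A j k) * u k) + (\<Sum>k\<in>I-J. of_int (A j k) * u k)"
    using sum.subset_diff[OF J(1) fin, of "\<lambda>k. of_int (A j k) * u k"] by simp
  also have "(\<Sum>k\<in>I-J. of_int (A j k) * u k) \<le> 0"
  proof (rule sum_nonpos)
    fix k assume "k \<in> I - J"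
    then show "of_int (A j k) * u k \<le> 0"
      using off[of j k] less_imp_le[OF u[of k]] j by (intro mult_nonpos_nonneg) auto
  qed
  also have "(\<Sum>k\<in>J. of_int (A j k) * u k) \<le> (\<Sum>k\<in>J. of_int (A j k) * u j)"
  proof (rule sum_mono)
    fix k assume k: "k \<in> J"
    show "of_int (A j k) * u k \<le> of_int (A j k) * u j"
    proof (cases "k = j")
      case False
      then show ?thesis using off[of j k] min[OF k] by (intro mult_left_mono_neg) auto
    qed simp
  qed
  finally have "0 < of_int (\<Sum>k\<in>J. A j k) * u j"
    by (simp add: sum_distrib_right)
  then have "(\<Sum>k\<in>J. A j k) > 0"
    using u[of j] j J by (auto simp: zero_less_mult_iff simp del: of_int_sum)
  then show ?thesis using j by blast
qed

text \<open>Cuts replace paths because they survive the deletion of a leaf without any rerouting: a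
  cut of the smaller set extends to a cut of \<open>J\<close>.\<close>

definition cut_connected :: "('i \<Rightarrow> 'i \<Rightarrow> int) \<Rightarrow> 'i set \<Rightarrow> bool" where
  "cut_connected A J \<longleftrightarrow>
     J \<noteq> {} \<and> (\<forall>S. S \<subset> J \<and> S \<noteq> {} \<longrightarrow> (\<exists>i\<in>S. \<exists>k\<in>J-S. A i k \<noteq> 0))"

text \<open>A path that starts in \<open>S\<close> and ends outside must leave \<open>S\<close> at
  some step.\<close>

lemma connected_subdiagram_imp_cut_connected:
  assumes "connected_subdiagram A I"
  shows "cut_connected A I"
  unfolding cut_connected_def
proof (intro conjI allI impI)
  show "I \<noteq> {}" using assms by (simp add: connected_subdiagram_def)
next
  fix S assume S: "S \<subset> I \<and> S \<noteq> {}"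
  then obtain i k where ik: "i \<in> S" "k \<in> I" "k \<notin> S" by blast
  let ?R = "{(k, l). k \<in> I \<and> l \<in> I \<and> k \<noteq> l \<and> A k l \<noteq> 0}"
  have "(i, k) \<in> ?R\<^sup>*" using assms ik S unfolding connected_subdiagram_def by blast
  then have "k \<in> S \<or> (\<exists>i\<in>S. \<exists>k\<in>I-S. A i k \<noteq> 0)"
    by (induction rule: rtrancl_induct) (use ik in auto)
  then show "\<exists>i\<in>S. \<exists>k\<in>I-S. A i k \<noteq> 0" using ik by blast
qed

text \<open>
  The row sum is \<open>2\<close> plus nonpositive integers, not all zero by connectedness. Its positivity
  leaves a single nonzero off-diagonal entry \<open>-1\<close>, so \<open>j\<close> is a leaf.
\<close>

lemma cut_connected_remove_leaf:
  fixes A :: "'i \<Rightarrow> 'i \<Rightarrow> int"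
  assumes fin: "finite J" and conn: "cut_connected A J" and j: "j \<in> J" and ne: "J \<noteq> {j}"
    and diag: "A j j = 2"
    and off: "\<And>i j. i \<noteq> j \<Longrightarrow> A i j \<le> 0"
    and zero: "\<And>i j. A i j = 0 \<Longrightarrow> A j i = 0"
    and pos: "(\<Sum>k\<in>J. A j k) > 0"
  shows "(\<Sum>k\<in>J - {j}. A j k) = -1" and "cut_connected A (J - {j})"
proof -
  have "{j} \<subset> J" using j ne by blast
  then obtain l where l: "l \<in> J" "l \<noteq> j" "A j l \<noteq> 0"
    using conn unfolding cut_connected_def by (metis DiffE insert_not_empty singletonD singletonI)
  have s1: "(\<Sum>k\<in>J. A j k) = 2 + (\<Sum>k\<in>J - {j}. A j k)"
    using sum.remove[OF fin j, of "A j"] diag by simp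
  have s2: "(\<Sum>k\<in>J - {j}. A j k) = A j l + (\<Sum>k\<in>J - {j} - {l}. A j k)"
    using sum.remove[of "J - {j}" l "A j"] fin l by simp
  have le: "(\<Sum>k\<in>J - {j} - {l}. A j k) \<le> 0"
    by (rule sum_nonpos) (use off in auto)
  have al: "A j l \<le> -1" using off[of j l] l by fastforce
  have s3: "(\<Sum>k\<in>J - {j} - {l}. A j k) = 0" using s1 s2 le al pos by linarith
  show "(\<Sum>k\<in>J - {j}. A j k) = -1" using s1 s2 le al pos by linarith
  have "(\<Sum>k\<in>J - {j} - {l}. - A j k) = 0 \<longleftrightarrow> (\<forall>k\<in>J - {j} - {l}. - A j k = 0)"
    by (rule sum_nonneg_eq_0_iff) (use fin off in auto)
  then have "\<forall>k\<in>J - {j} - {l}. A j k = 0"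
    using s3 by (simp add: sum_negf)
  then have only: "k = l" if "k \<in> J" "k \<noteq> j" "A j k \<noteq> 0 \<or> A k j \<noteq> 0" for k
    using that zero by blast
  show "cut_connected A (J - {j})"
    unfolding cut_connected_def
  proof (intro conjI allI impI)
    show "J - {j} \<noteq> {}" using l by blast
  next
    fix S assume S: "S \<subset> J - {j} \<and> S \<noteq> {}"
    show "\<exists>i\<in>S. \<exists>k\<in>J - {j} - S. A i k \<noteq> 0"
    proof (cases "l \<in> S")
      case True
      \<comment> \<open>The leaf \<open>j\<close> is put on the side of its only neighbour
        \<open>l\<close>, so the edge crossing the enlarged cut avoids \<open>j\<close>. In the
        other case \<open>j\<close> and \<open>l\<close> both lie outside \<open>S\<close>, with the
        same effect.\<close>
      have "insert j S \<subset> J" using S j by blast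
      then obtain i k where "i \<in> insert j S" "k \<in> J - insert j S" "A i k \<noteq> 0"
        using conn unfolding cut_connected_def by (meson insert_not_empty)
      then show ?thesis using only True by blast
    next
      case False
      have "S \<subset> J" using S by blast
      then obtain i k where "i \<in> S" "k \<in> J - S" "A i k \<noteq> 0"
        using conn S unfolding cut_connected_def by meson
      then show ?thesis using only False S by blast
    qed
  qed
qed

section \<open>Weights of Kac--Moody algebras\<close>

text \<open>Right-normed brackets are stable under bracketing with a generator by construction. For
  the Chevalley generators they span the positive or the negative part of the algebra.\<close>

inductive_set iterated_brackets :: "('g \<Rightarrow> 'g \<Rightarrow> 'g) \<Rightarrow> ('i \<Rightarrow> 'g) \<Rightarrow> 'g set"
  for br :: "'g \<Rightarrow> 'g \<Rightarrow> 'g" and e :: "'i \<Rightarrow> 'g" where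
  gen: "e i \<in> iterated_brackets br e"
| step: "x \<in> iterated_brackets br e \<Longrightarrow> br (e i) x \<in> iterated_brackets br e"

section \<open>Bracket identities\<close>

context lie_algebra
begin

lemma br_add_left: "br (x + y) z = br x z + br y z"
  using linear_left[of z] by (simp add: Vector_Spaces.linear_iff)

lemma br_add_right: "br x (y + z) = br x y + br x z"
  using linear_right[of x] by (simp add: Vector_Spaces.linear_iff)

lemma br_scale_left: "br (scale c x) z = scale c (br x z)"
  using linear_left[of z] by (simp add: Vector_Spaces.linear_iff)

lemma br_scale_right: "br x (scale c z) = scale c (br x z)"
  using linear_right[of x] by (simp add: Vector_Spaces.linear_iff)

lemma br_zero_left [simp]: "br 0 x = 0"
  using br_add_left[of 0 0 x] by simp

lemma br_zero_right [simp]: "br x 0 = 0"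
  using br_add_right[of x 0 0] by simp

lemma br_antisym: "br y x = - br x y"
proof -
  have "br (x + y) (x + y) = br x x + br y x + (br x y + br y y)"
    by (simp only: br_add_left br_add_right)
  then have "br x y + br y x = 0" by (simp add: alternating add.commute)
  then show ?thesis by (simp add: eq_neg_iff_add_eq_0 add.commute)
qed

lemma br_minus_right: "br x (- y) = - br x y"
  using br_add_right[of x y "-y"] by (simp add: eq_neg_iff_add_eq_0 add.commute)

lemma br_minus_left: "br (- x) y = - br x y"
  by (simp only: br_antisym[of _ y] br_minus_right)

lemma br_sum_right: "br x (sum f S) = (\<Sum>a\<in>S. br x (f a))"
  by (induction S rule: infinite_finite_induct) (auto simp: br_add_right)

lemma br_derivation: "br x (br y z) = br (br x y) z + br y (br x z)"
proof -
  have "br x (br y z) + br y (br z x) + br z (br x y) = 0" by (rule jacobi)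
  moreover have "br y (br z x) = - br y (br x z)" by (metis br_antisym br_minus_right)
  moreover have "br z (br x y) = - br (br x y) z" by (rule br_antisym)
  ultimately show ?thesis by (simp add: algebra_simps)
qed

lemma br_span_right:
  assumes "x \<in> span S" and "\<And>a. a \<in> S \<Longrightarrow> br y a \<in> span T"
  shows "br y x \<in> span T"
  using assms(1)
  by (induction rule: span_induct_alt)
    (auto simp: br_add_right br_scale_right intro: assms(2) span_add span_scale span_zero)

text \<open>Bracketing with \<open>f i\<close> is a derivation: on \<open>br (e j) x\<close> it
  gives \<open>br (f i) (e j)\<close>, an element of \<open>H\<close>, acting on \<open>x\<close>,
  plus \<open>e j\<close> acting on the value at \<open>x\<close>. With \<open>e\<close> and
  \<open>f\<close> arbitrary, the lemma serves both halves of the triangular decomposition.\<close>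

lemma iterated_brackets_opposite:
  assumes fe: "\<And>i j. br (f i) (e j) \<in> H"
    and H: "\<And>h x. h \<in> H \<Longrightarrow> x \<in> iterated_brackets br e \<Longrightarrow> br h x \<in> span (iterated_brackets br e)"
    and x: "x \<in> iterated_brackets br e"
  shows "br (f i) x \<in> span (H \<union> iterated_brackets br e)"
  using x
proof (induction rule: iterated_brackets.induct)
  case (gen j)
  then show ?case using fe by (blast intro: span_base)
next
  case (step x j)
  have "br (e j) a \<in> span (iterated_brackets br e)" if "a \<in> H \<union> iterated_brackets br e" for a
  proof (cases "a \<in> H")
    case True
    then show ?thesis
      using H[OF True iterated_brackets.gen[of e j br]] br_antisym[of a "e j"]
      by (metis span_neg br_antisym)
  next
    case False
    then show ?thesis using that by (blast intro: span_base iterated_brackets.step)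
  qed
  then have "br (e j) (br (f i) x) \<in> span (iterated_brackets br e)"
    using step.IH br_span_right by blast
  moreover have "br (br (f i) (e j)) x \<in> span (iterated_brackets br e)"
    using fe H step.hyps by blast
  ultimately have "br (f i) (br (e j) x) \<in> span (iterated_brackets br e)"
    by (simp add: br_derivation[of "f i"] span_add)
  then show ?case using span_mono by blast
qed

end

interpretation dual: vector_space dual_scale
  by unfold_locales (auto simp: dual_scale_def fun_eq_iff algebra_simps)

text \<open>Independence concerns the set of vectors; injectivity of \<open>b\<close> lets
  \<open>inv b\<close> carry the coefficients over to the indices.\<close>

lemma (in vector_space) independent_family_eq:
  assumes ind: "\<not> dependent (range b)" and inj: "inj b"
    and eq: "(\<Sum>i\<in>UNIV. scale (c i) (b i)) = (\<Sum>i\<in>UNIV. scale (d i) (b i))"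
  shows "c (i :: 'i::finite) = d i"
proof -
  let ?u = "\<lambda>v. c (inv b v) - d (inv b v)"
  have "(\<Sum>v\<in>range b. scale (?u v) v) = (\<Sum>i\<in>UNIV. scale (c i - d i) (b i))"
    using inj by (simp add: sum.reindex)
  also have "\<dots> = 0" using eq by (simp add: scale_left_diff_distrib sum_subtractf)
  finally have "?u (b i) = 0"
    using independentD[OF ind, of "range b" ?u "b i"] by simp
  then show ?thesis using inj by simp
qed

section \<open>Generators, Cartan subalgebra and its dual\<close>

locale kac_moody =
  fixes A :: "'i::finite \<Rightarrow> 'i \<Rightarrow> int"
    and G :: "('i, 'h::ab_group_add, 'g::ab_group_add) kac_moody_data"
  assumes kac_moody_algebra: "kac_moody_algebra A G"
begin

abbreviation "\<alpha> \<equiv> simple_root G"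
abbreviation "\<alpha>v \<equiv> simple_coroot G"
abbreviation "e \<equiv> chevalley_e G"
abbreviation "f \<equiv> chevalley_f G"
abbreviation "\<iota> \<equiv> incl G"

sublocale lie_algebra "gscale G" "bracket G"
  using kac_moody_algebra by (simp add: kac_moody_algebra_def)

sublocale cartan: vector_space "hscale G"
  using kac_moody_algebra by (simp add: kac_moody_algebra_def realization_def)

lemma diag: "A i i = 2"
  and off_diag: "i \<noteq> j \<Longrightarrow> A i j \<le> 0"
  and zero_sym: "A i j = 0 \<Longrightarrow> A j i = 0"
  using kac_moody_algebra
  by (auto simp: kac_moody_algebra_def generalized_cartan_matrix_def nonpos_Ints_int_le)

lemma simple_root_in_dual: "\<alpha> i \<in> dual_space G"
  and inj_simple_root: "inj \<alpha>"
  and independent_simple_roots: "\<not> dual.dependent (range \<alpha>)"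
  and independent_simple_coroots: "\<not> cartan.dependent (range \<alpha>v)"
  and simple_root_coroot: "\<alpha> j (\<alpha>v i) = of_int (A i j)"
  using kac_moody_algebra by (auto simp: kac_moody_algebra_def realization_def)

lemma linear_incl: "Vector_Spaces.linear (hscale G) (gscale G) \<iota>"
  and inj_incl: "inj \<iota>"
  and bracket_cartan: "bracket G (\<iota> h) (\<iota> h') = 0"
  and bracket_cartan_e: "bracket G (\<iota> h) (e i) = gscale G (\<alpha> i h) (e i)"
  and bracket_cartan_f: "bracket G (\<iota> h) (f i) = gscale G (- \<alpha> i h) (f i)"
  and bracket_e_f: "bracket G (e i) (f j) = (if i = j then \<iota> (\<alpha>v i) else 0)"
  using kac_moody_algebra by (auto simp: kac_moody_algebra_def)

lemma subalgebra_eq_UNIV: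
  assumes "lie_subalgebra (gscale G) (bracket G) S"
    and "range \<iota> \<subseteq> S" "range e \<subseteq> S" "range f \<subseteq> S"
  shows "S = UNIV"
  using kac_moody_algebra assms by (auto simp: kac_moody_algebra_def)

lemma incl_zero: "\<iota> 0 = 0"
  and incl_diff: "\<iota> (h - h') = \<iota> h - \<iota> h'"
  and incl_scale: "\<iota> (hscale G c h) = gscale G c (\<iota> h)"
proof -
  interpret incl: Vector_Spaces.linear "hscale G" "gscale G" \<iota> by (rule linear_incl)
  show "\<iota> 0 = 0" "\<iota> (h - h') = \<iota> h - \<iota> h'"
    "\<iota> (hscale G c h) = gscale G c (\<iota> h)"
    by (simp_all add: incl.zero incl.diff incl.scale)
qed

lemma dual_diff: "\<mu> \<in> dual_space G \<Longrightarrow> \<mu> (h - h') = \<mu> h - \<mu> h'"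
  and dual_scale': "\<mu> \<in> dual_space G \<Longrightarrow> \<mu> (hscale G c h) = c * \<mu> h"
proof -
  assume "\<mu> \<in> dual_space G"
  then interpret mu: Vector_Spaces.linear "hscale G" "(*)" \<mu> by (simp add: dual_space_def)
  show "\<mu> (h - h') = \<mu> h - \<mu> h'" "\<mu> (hscale G c h) = c * \<mu> h"
    by (simp_all add: mu.diff mu.scale)
qed

lemma vector_space_complex: "vector_space ((*) :: complex \<Rightarrow> _)"
  by unfold_locales (auto simp: algebra_simps)

lemma dual_spaceI:
  assumes "\<And>h h'. \<mu> (h + h') = \<mu> h + \<mu> h'" and "\<And>c h. \<mu> (hscale G c h) = c * \<mu> h"
  shows "\<mu> \<in> dual_space G"
  unfolding dual_space_def
  using assms vector_space_complex cartan.vector_space_axioms by (simp add: Vector_Spaces.linear_iff)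

lemma dual_add: "\<mu> \<in> dual_space G \<Longrightarrow> \<mu> (h + h') = \<mu> h + \<mu> h'"
  by (simp add: dual_space_def Vector_Spaces.linear_iff)

lemma dual_space_diff: "\<mu> \<in> dual_space G \<Longrightarrow> \<nu> \<in> dual_space G \<Longrightarrow> \<mu> - \<nu> \<in> dual_space G"
  by (rule dual_spaceI) (auto simp: dual_add dual_scale' algebra_simps)

lemma dual_space_scale: "\<mu> \<in> dual_space G \<Longrightarrow> dual_scale c \<mu> \<in> dual_space G"
  by (rule dual_spaceI) (auto simp: dual_add dual_scale' dual_scale_def algebra_simps)

lemma sum_fun_apply: "(\<Sum>i\<in>J. g i) h = (\<Sum>i\<in>J. g i h)" for g :: "'k \<Rightarrow> 'a \<Rightarrow> 'b::comm_monoid_add"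
  by (induction J rule: infinite_finite_induct) auto

lemma dual_space_sum: "(\<Sum>i\<in>J. \<alpha> i) \<in> dual_space G"
  by (rule dual_spaceI)
    (auto simp: sum_fun_apply dual_add dual_scale' simple_root_in_dual sum.distrib sum_distrib_left)

lemma simple_coroot_nonzero: "\<alpha>v i \<noteq> 0"
  using independent_simple_coroots cartan.dependent_zero[of "range \<alpha>v"] rangeI[of \<alpha>v i] by auto

text \<open>Otherwise the bracket of \<open>e i\<close> with \<open>f i\<close>, which is the image
  of a nonzero coroot, would vanish.\<close>

lemma e_nonzero: "e i \<noteq> 0"
proof
  assume "e i = 0"
  then have "\<iota> (\<alpha>v i) = 0" using bracket_e_f[of i i] by simp
  then show False
    using simple_coroot_nonzero inj_incl incl_zero by (metis injD)
qed

section \<open>Weight vectors and the support of the weights\<close>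

lemma root_space_scale: "x \<in> root_space G \<mu> \<Longrightarrow> gscale G c x \<in> root_space G \<mu>"
  by (simp add: root_space_def br_scale_right mult.commute)

lemma root_space_bracket:
  assumes "x \<in> root_space G \<mu>" and "y \<in> root_space G \<nu>"
  shows "bracket G x y \<in> root_space G (\<mu> + \<nu>)"
  using assms
  by (simp add: root_space_def br_derivation[of "\<iota> _"] br_scale_left br_scale_right
      scale_left_distrib)

lemma e_in_root_space: "e i \<in> root_space G (\<alpha> i)"
  by (simp add: root_space_def bracket_cartan_e)

lemma f_in_root_space: "f i \<in> root_space G (- \<alpha> i)"
  by (simp add: root_space_def bracket_cartan_f)

text \<open>Choose \<open>h\<close> separating \<open>wt b\<close> from \<mu> and apply the action
  of \<open>h\<close> minus \<open>wt b h\<close>. This removes \<open>y b\<close>, rescales the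
  other terms, and multiplies the whole sum by a nonzero number. The weights \<open>wt a\<close> may
  coincide with each other.\<close>

lemma weight_vector_sum_eq_0:
  assumes "finite T"
    and "\<And>a. a \<in> T \<Longrightarrow> y a \<in> root_space G (wt a)" and "\<And>a. a \<in> T \<Longrightarrow> wt a \<noteq> \<mu>"
    and "(\<Sum>a\<in>T. y a) \<in> root_space G \<mu>"
  shows "(\<Sum>a\<in>T. y a) = 0"
  using assms
proof (induction T arbitrary: y rule: finite_induct)
  case empty
  then show ?case by simp
next
  case (insert b T)
  let ?z = "\<Sum>a\<in>insert b T. y a"
  obtain h where h: "wt b h \<noteq> \<mu> h" using insert.prems(2) by blast
  let ?y = "\<lambda>a. gscale G (wt a h - wt b h) (y a)"
  have "gscale G (\<mu> h - wt b h) ?z = bracket G (\<iota> h) ?z - gscale G (wt b h) ?z"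
    using insert.prems(3) by (simp add: root_space_def scale_left_diff_distrib)
  also have "\<dots> = (\<Sum>a\<in>insert b T. bracket G (\<iota> h) (y a) - gscale G (wt b h) (y a))"
    by (simp only: br_sum_right scale_sum_right sum_subtractf)
  also have "\<dots> = (\<Sum>a\<in>insert b T. ?y a)"
    using insert.prems(1) by (intro sum.cong) (auto simp: root_space_def scale_left_diff_distrib)
  also have "\<dots> = (\<Sum>a\<in>T. ?y a)" using insert.hyps by simp
  finally have eq: "gscale G (\<mu> h - wt b h) ?z = (\<Sum>a\<in>T. ?y a)" .
  have "(\<Sum>a\<in>T. ?y a) = 0"
  proof (rule insert.IH)
    show "(\<Sum>a\<in>T. ?y a) \<in> root_space G \<mu>"
      using root_space_scale[OF insert.prems(3)] eq by metis
  qed (use insert.prems root_space_scale in auto)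
  then show ?case using eq h by (simp add: scale_eq_0_iff)
qed

lemma weight_in_generating_weights:
  assumes x: "x \<in> span (\<Union>\<nu>\<in>L. root_space G \<nu>)" "x \<in> root_space G \<mu>" "x \<noteq> 0"
  shows "\<mu> \<in> L"
proof (rule ccontr)
  assume "\<mu> \<notin> L"
  obtain T r where T: "finite T" "T \<subseteq> (\<Union>\<nu>\<in>L. root_space G \<nu>)"
    and xT: "x = (\<Sum>a\<in>T. gscale G (r a) a)"
    using x(1) unfolding span_explicit by blast
  from T(2) have "\<forall>a\<in>T. \<exists>\<nu>\<in>L. a \<in> root_space G \<nu>" by blast
  then obtain wt where wt: "\<And>a. a \<in> T \<Longrightarrow> wt a \<in> L \<and> a \<in> root_space G (wt a)"
    by metis
  have "(\<Sum>a\<in>T. gscale G (r a) a) = 0"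
    by (rule weight_vector_sum_eq_0[OF T(1), of _ wt \<mu>])
      (use wt root_space_scale \<open>\<mu> \<notin> L\<close> x(2) xT in auto)
  then show False using x(3) xT by simp
qed

text \<open>The coefficients are written with \<open>of_nat\<close> to match the natural number
  coefficients of \<open>iterated_brackets_weight\<close>.\<close>

lemma sum_dual_delta: "(\<Sum>k\<in>UNIV. dual_scale (of_nat (of_bool (k = i))) (\<beta> k)) = \<beta> i"
  for i :: 'i
proof -
  have "(\<Sum>k\<in>UNIV. dual_scale (of_nat (of_bool (k = i))) (\<beta> k))
      = (\<Sum>k\<in>UNIV. if k = i then \<beta> k else 0)"
    by (intro sum.cong) auto
  then show ?thesis by simp
qed

text \<open>Each bracketing with \<open>y i\<close> raises the coefficient of
  \<open>\<beta> i\<close> by one. It is applied to \<open>e\<close> with the simple roots and to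
  \<open>f\<close> with their negatives.\<close>

lemma iterated_brackets_weight:
  assumes "\<And>i. y i \<in> root_space G (\<beta> i)" and "x \<in> iterated_brackets (bracket G) y"
  shows "\<exists>n :: 'i \<Rightarrow> nat. x \<in> root_space G (\<Sum>i\<in>UNIV. dual_scale (of_nat (n i)) (\<beta> i))"
  using assms(2)
proof (induction rule: iterated_brackets.induct)
  case (gen i)
  have "(\<Sum>k\<in>UNIV. dual_scale (of_nat (of_bool (k = i))) (\<beta> k)) = \<beta> i"
    by (simp only: sum_dual_delta)
  then show ?case using assms(1)[of i] by metis
next
  case (step x i)
  then obtain n where n: "x \<in> root_space G (\<Sum>k\<in>UNIV. dual_scale (of_nat (n k)) (\<beta> k))" by blast
  have "(\<Sum>k\<in>UNIV. dual_scale (of_nat (of_bool (k = i) + n k)) (\<beta> k))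
      = \<beta> i + (\<Sum>k\<in>UNIV. dual_scale (of_nat (n k)) (\<beta> k))"
    by (simp only: of_nat_add dual.scale_left_distrib sum.distrib sum_dual_delta)
  then show ?case
    using root_space_bracket[OF assms(1)[of i] n]
    by (intro exI[of _ "\<lambda>k. of_bool (k = i) + n k"]) (simp only:)
qed

text \<open>
  The span of \<open>h\<close> and the iterated brackets is stable under all generators, so its normalizer, and
  then the span itself, is the whole algebra.
\<close>

lemma triangular_decomposition:
  "span (range \<iota> \<union> iterated_brackets (bracket G) e \<union> iterated_brackets (bracket G) f) = UNIV"
    (is "span (?H \<union> ?E \<union> ?F) = UNIV")
proof -
  let ?B = "?H \<union> ?E \<union> ?F"
  \<comment> \<open>Iterated brackets are weight vectors, so the Cartan subalgebra acts on each by a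
    scalar.\<close>
  have hw: "bracket G h x \<in> span (iterated_brackets (bracket G) y)"
    if h: "h \<in> ?H" and x: "x \<in> iterated_brackets (bracket G) y"
      and y: "\<And>i. y i \<in> root_space G (\<beta> i)"
    for h x and \<beta> :: "'i \<Rightarrow> _" and y
  proof -
    obtain \<mu> where "x \<in> root_space G \<mu>" using iterated_brackets_weight[OF y x] by blast
    then show ?thesis using h span_scale[OF span_base[OF x]] by (auto simp: root_space_def)
  qed
  have hE: "bracket G h x \<in> span ?E" if "h \<in> ?H" "x \<in> ?E" for h x
    using hw[OF that e_in_root_space] .
  have hF: "bracket G h x \<in> span ?F" if "h \<in> ?H" "x \<in> ?F" for h x
    using hw[OF that f_in_root_space] .
  have ef: "bracket G (e i) (f j) \<in> ?H" for i j
    using bracket_e_f incl_zero by (metis rangeI)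
  have fe: "bracket G (f i) (e j) \<in> ?H" for i j
  proof -
    have "bracket G (f i) (e j) = \<iota> (0 - (if i = j then \<alpha>v i else 0))"
      using br_antisym[of "f i" "e j"] bracket_e_f[of j i] incl_diff[of 0 "\<alpha>v i"] incl_zero by auto
    then show ?thesis by blast
  qed
  have sub: "span ?E \<subseteq> span ?B" "span ?F \<subseteq> span ?B" "span (?H \<union> ?E) \<subseteq> span ?B"
    "span (?H \<union> ?F) \<subseteq> span ?B"
    by (rule span_mono; blast)+
  let ?N = "{y. \<forall>x\<in>span ?B. bracket G y x \<in> span ?B}"
  have gens: "y \<in> ?N" if "\<And>a. a \<in> ?B \<Longrightarrow> bracket G y a \<in> span ?B" for y
    using br_span_right that by blast
  have "?N = UNIV"
  proof (rule subalgebra_eq_UNIV)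
    show "lie_subalgebra (gscale G) (bracket G) ?N"
      unfolding lie_subalgebra_def
    proof (intro conjI ballI)
      show "subspace ?N"
        by (auto simp: subspace_def br_add_left br_scale_left span_add span_scale span_zero)
    next
      fix x y assume xy: "x \<in> ?N" "y \<in> ?N"
      show "bracket G x y \<in> ?N"
      proof (intro CollectI ballI)
        fix z assume "z \<in> span ?B"
        moreover have "bracket G (bracket G x y) z
            = bracket G x (bracket G y z) - bracket G y (bracket G x z)"
          by (simp add: br_derivation[of x y z])
        ultimately show "bracket G (bracket G x y) z \<in> span ?B"
          using xy by (simp add: span_diff)
      qed
    qed
    show "range \<iota> \<subseteq> ?N"
    proof (clarify, rule gens[THEN CollectD, rule_format])
      fix h a x assume "a \<in> ?B"
      then consider "a \<in> ?H" | "a \<in> ?E" | "a \<in> ?F" by blast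
      then show "bracket G (\<iota> h) a \<in> span ?B"
      proof cases
        case 1
        then show ?thesis by (auto simp: bracket_cartan span_zero)
      next
        case 2
        show ?thesis using hE[OF rangeI 2] sub(1) by (rule subsetD[rotated])
      next
        case 3
        show ?thesis using hF[OF rangeI 3] sub(2) by (rule subsetD[rotated])
      qed
    qed
    show "range e \<subseteq> ?N"
    proof (clarify, rule gens[THEN CollectD, rule_format])
      fix i a x assume "a \<in> ?B"
      then consider "a \<in> ?H" | "a \<in> ?E" | "a \<in> ?F" by blast
      then show "bracket G (e i) a \<in> span ?B"
      proof cases
        case 1
        have "bracket G a (e i) \<in> span ?B"
          using hE[OF 1 iterated_brackets.gen] sub(1) by (rule subsetD[rotated])
        then show ?thesis by (simp only: br_antisym[of "e i" a] span_neg)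
      next
        case 2
        then have "bracket G (e i) a \<in> ?E" by (rule iterated_brackets.step)
        then show ?thesis by (intro span_base) simp
      next
        case 3
        show ?thesis
          using iterated_brackets_opposite[OF ef hF 3] sub(4) by (rule subsetD[rotated])
      qed
    qed
    show "range f \<subseteq> ?N"
    proof (clarify, rule gens[THEN CollectD, rule_format])
      fix i a x assume "a \<in> ?B"
      then consider "a \<in> ?H" | "a \<in> ?F" | "a \<in> ?E" by blast
      then show "bracket G (f i) a \<in> span ?B"
      proof cases
        case 1
        have "bracket G a (f i) \<in> span ?B"
          using hF[OF 1 iterated_brackets.gen] sub(2) by (rule subsetD[rotated])
        then show ?thesis by (simp only: br_antisym[of "f i" a] span_neg)
      next
        case 2
        then have "bracket G (f i) a \<in> ?F" by (rule iterated_brackets.step)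
        then show ?thesis by (intro span_base) simp
      next
        case 3
        show ?thesis
          using iterated_brackets_opposite[OF fe hE 3] sub(3) by (rule subsetD[rotated])
      qed
    qed
  qed
  \<comment> \<open>As \<open>?N\<close> is everything, \<open>span ?B\<close> absorbs all brackets;
    it also contains the generators.\<close>
  then have "lie_subalgebra (gscale G) (bracket G) (span ?B)"
    unfolding lie_subalgebra_def by (auto simp: subspace_span)
  then show ?thesis
    by (rule subalgebra_eq_UNIV) (auto intro: span_base iterated_brackets.gen)
qed

text \<open>The triangular decomposition spans the algebra by vectors of weight zero, of positive
  weight or of negative weight, so no other weight occurs. Independence of the simple roots then
  identifies the coefficients; \<open>c\<close> is complex, so integrality is part of the
  result.\<close>

lemma root_coefficients:
  assumes "is_root G (\<Sum>i\<in>UNIV. dual_scale (c i) (\<alpha> i))" (is "is_root G ?\<mu>")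
  shows "(\<forall>i. c i \<in> \<nat>) \<or> (\<forall>i. - c i \<in> \<nat>)"
proof -
  let ?wt = "\<lambda>n :: 'i \<Rightarrow> nat. \<Sum>i\<in>UNIV. dual_scale (of_nat (n i)) (\<alpha> i)"
  let ?wt' = "\<lambda>n :: 'i \<Rightarrow> nat. \<Sum>i\<in>UNIV. dual_scale (- of_nat (n i)) (\<alpha> i)"
  let ?L = "range ?wt \<union> range ?wt'"
  let ?R = "\<Union>\<nu>\<in>?L. root_space G \<nu>"
  \<comment> \<open>Being different from \<open>{0}\<close> would also allow the empty set; this
    excludes it.\<close>
  have "0 \<in> root_space G ?\<mu>" by (simp add: root_space_def)
  then obtain x where x: "x \<in> root_space G ?\<mu>" "x \<noteq> 0"
    using assms unfolding is_root_def by fastforce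
  have R: "y \<in> root_space G (?wt n) \<Longrightarrow> y \<in> ?R" for y n
    by (rule UN_I[OF UnI1[OF rangeI[of ?wt n]]])
  have R': "y \<in> root_space G (?wt' n) \<Longrightarrow> y \<in> ?R" for y n
    by (rule UN_I[OF UnI2[OF rangeI[of ?wt' n]]])
  have "range \<iota> \<subseteq> ?R"
  proof clarify
    fix h
    have "\<iota> h \<in> root_space G (?wt (\<lambda>_. 0))"
      by (simp add: root_space_def bracket_cartan)
    then show "\<iota> h \<in> ?R" by (rule R)
  qed
  moreover have "iterated_brackets (bracket G) e \<subseteq> ?R"
  proof
    fix x assume x: "x \<in> iterated_brackets (bracket G) e"
    obtain n where "x \<in> root_space G (?wt n)"
      using iterated_brackets_weight[OF e_in_root_space x] by (elim exE)
    then show "x \<in> ?R" by (rule R)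
  qed
  moreover have "iterated_brackets (bracket G) f \<subseteq> ?R"
  proof
    fix x assume x: "x \<in> iterated_brackets (bracket G) f"
    obtain n :: "'i \<Rightarrow> nat"
      where "x \<in> root_space G (\<Sum>i\<in>UNIV. dual_scale (of_nat (n i)) (- \<alpha> i))"
      using iterated_brackets_weight[OF f_in_root_space x] by (elim exE)
    then have "x \<in> root_space G (?wt' n)"
      by (simp only: dual.scale_minus_right dual.scale_minus_left)
    then show "x \<in> ?R" by (rule R')
  qed
  ultimately have "span ?R = UNIV"
    using span_mono[OF Un_least[OF Un_least]] triangular_decomposition
    by (metis (no_types, lifting) top.extremum_uniqueI)
  then have "x \<in> span ?R" by simp
  then have "?\<mu> \<in> ?L" using x by (rule weight_in_generating_weights)
  then show ?thesis
  proof
    assume "?\<mu> \<in> range ?wt"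
    then obtain n :: "'i \<Rightarrow> nat" where n: "?\<mu> = ?wt n" by blast
    have "c i = of_nat (n i)" for i
      by (rule dual.independent_family_eq[OF independent_simple_roots inj_simple_root n])
    then show ?thesis by simp
  next
    assume "?\<mu> \<in> range ?wt'"
    then obtain n :: "'i \<Rightarrow> nat" where n: "?\<mu> = ?wt' n" by blast
    have "c i = - of_nat (n i)" for i
      by (rule dual.independent_family_eq[OF independent_simple_roots inj_simple_root n])
    then show ?thesis by simp
  qed
qed

lemma sum_simple_roots: "(\<Sum>i\<in>J. \<alpha> i) = (\<Sum>i\<in>UNIV. dual_scale (of_bool (i \<in> J)) (\<alpha> i))"
proof -
  have "(\<Sum>i\<in>UNIV. dual_scale (of_bool (i \<in> J)) (\<alpha> i)) = (\<Sum>i\<in>UNIV. if i \<in> J then \<alpha> i else 0)"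
    by (intro sum.cong) auto
  then show ?thesis by (simp add: sum.If_cases)
qed

lemma sum_simple_roots_inj: "(\<Sum>i\<in>J. \<alpha> i) = (\<Sum>i\<in>K. \<alpha> i) \<Longrightarrow> J = K"
proof -
  assume "(\<Sum>i\<in>J. \<alpha> i) = (\<Sum>i\<in>K. \<alpha> i)"
  then have "(of_bool (i \<in> J) :: complex) = of_bool (i \<in> K)" for i
    unfolding sum_simple_roots
    by (rule dual.independent_family_eq[OF independent_simple_roots inj_simple_root])
  then show "J = K" by (simp add: set_eq_iff of_bool_eq_iff)
qed

text \<open>The difference has a coefficient 1 on \<open>J\<close> and a coefficient -1 on
  \<open>K\<close>, hence mixed signs.\<close>

lemma not_root_diff_sums:
  assumes "J \<inter> K = {}" "J \<noteq> {}" "K \<noteq> {}"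
  shows "\<not> is_root G ((\<Sum>i\<in>J. \<alpha> i) - (\<Sum>i\<in>K. \<alpha> i))"
proof
  let ?c = "\<lambda>i. of_bool (i \<in> J) - of_bool (i \<in> K) :: complex"
  assume "is_root G ((\<Sum>i\<in>J. \<alpha> i) - (\<Sum>i\<in>K. \<alpha> i))"
  then have "is_root G (\<Sum>i\<in>UNIV. dual_scale (?c i) (\<alpha> i))"
    by (simp add: sum_simple_roots[of J] sum_simple_roots[of K] sum_subtractf
        dual.scale_left_diff_distrib)
  then have c: "(\<forall>i. ?c i \<in> \<nat>) \<or> (\<forall>i. - ?c i \<in> \<nat>)" by (rule root_coefficients)
  obtain j k where jk: "j \<in> J" "j \<notin> K" "k \<in> K" "k \<notin> J" using assms by blast
  have "(-1 :: complex) \<notin> \<nat>"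
  proof
    assume "(-1 :: complex) \<in> \<nat>"
    then obtain n where "(-1 :: complex) = of_nat n" by (rule Nats_cases)
    then have "Re (-1) = real n" by simp
    then show False by simp
  qed
  then show False using c jk by (auto dest: spec[of _ j] spec[of _ k])
qed

section \<open>Sums of simple roots over connected subdiagrams of finite type\<close>

text \<open>The basic sl_2 computation: the bracket of \<open>f j\<close> with \<open>e j\<close> is
  minus the coroot, which acts on \<open>x\<close> by a scalar. When \<mu> pairs to -1 with the
  coroot, the result is \<open>x\<close> itself.\<close>

lemma bracket_f_bracket_e:
  assumes "x \<in> root_space G \<mu>" "bracket G (f j) x = 0"
  shows "bracket G (f j) (bracket G (e j) x) = gscale G (- \<mu> (\<alpha>v j)) x"
  using assms br_antisym[of "f j" "e j"]
  by (simp add: br_derivation[of "f j"] bracket_e_f root_space_def br_minus_left)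

text \<open>The induction carries a root vector killed by every \<open>f j\<close> with
  \<open>j\<close> outside \<open>J\<close>. This is what makes \<open>bracket_f_bracket_e\<close>
  applicable when the next leaf is attached.\<close>

lemma real_root_sum:
  assumes "J \<subseteq> I" and "cut_connected A J"
    and u: "\<And>j. j \<in> I \<Longrightarrow> u j > (0::real)"
    and Au: "\<And>i. i \<in> I \<Longrightarrow> (\<Sum>j\<in>I. of_int (A i j) * u j) > 0"
  shows "(\<exists>w i. (\<Sum>i\<in>J. \<alpha> i) = foldr (reflection G) w (\<alpha> i)) \<and>
    (\<exists>x. x \<in> root_space G (\<Sum>i\<in>J. \<alpha> i) \<and> x \<noteq> 0 \<and> (\<forall>j. j \<notin> J \<longrightarrow> bracket G (f j) x = 0))"
  using finite[of J] assms(1,2)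
proof (induction J rule: finite_psubset_induct)
  case (psubset J)
  have "J \<noteq> {}" using psubset.prems by (simp add: cut_connected_def)
  then obtain j where j: "j \<in> J" "(\<Sum>k\<in>J. A j k) > 0"
    using finite_type_row_sum_pos[OF finite psubset.prems(1), of A u] off_diag u Au by blast
  show ?case
  proof (cases "J = {j}")
    case True
    have "foldr (reflection G) [] (\<alpha> j) = \<alpha> j" by simp
    moreover have "bracket G (f k) (e j) = 0" if "k \<noteq> j" for k
      using br_antisym[of "f k" "e j"] bracket_e_f that by simp
    ultimately show ?thesis
      using True e_in_root_space[of j] e_nonzero[of j]
      by (intro conjI exI[of _ "[]"] exI[of _ j] exI[of _ "e j"]) auto
  next
    case False
    have leaf: "(\<Sum>k\<in>J - {j}. A j k) = -1" "cut_connected A (J - {j})"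
      by (rule cut_connected_remove_leaf[OF finite psubset.prems(2) j(1) False diag _ _ j(2)];
          use off_diag zero_sym in blast)+
    let ?\<gamma> = "\<Sum>i\<in>J - {j}. \<alpha> i"
    have sum: "(\<Sum>i\<in>J. \<alpha> i) = \<alpha> j + ?\<gamma>"
      using j(1) by (simp add: sum.remove)
    have pairing: "?\<gamma> (\<alpha>v j) = -1"
      using leaf(1) by (simp add: sum_fun_apply simple_root_coroot flip: of_int_sum)
    have "J - {j} \<subset> J" "J - {j} \<subseteq> I" using j(1) psubset.prems(1) by auto
    note IH = psubset.IH[OF this leaf(2)]
    obtain w i where w: "?\<gamma> = foldr (reflection G) w (\<alpha> i)"
      using conjunct1[OF IH] by (elim exE)
    obtain x where x: "x \<in> root_space G ?\<gamma>" "x \<noteq> 0"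
        "\<And>k. k \<notin> J - {j} \<Longrightarrow> bracket G (f k) x = 0"
      using conjunct2[OF IH] by (elim exE conjE) metis
    \<comment> \<open>The pairing -1 makes the reflection add exactly one copy of
      \<open>\<alpha> j\<close>.\<close>
    have "(\<Sum>i\<in>J. \<alpha> i) = reflection G j ?\<gamma>"
      using pairing by (simp add: sum reflection_def)
    then have "(\<Sum>i\<in>J. \<alpha> i) = foldr (reflection G) (j # w) (\<alpha> i)" using w by simp
    moreover have "bracket G (e j) x \<in> root_space G (\<Sum>i\<in>J. \<alpha> i)"
      using root_space_bracket[OF e_in_root_space x(1)] sum by simp
    moreover have "bracket G (e j) x \<noteq> 0"
      using bracket_f_bracket_e[OF x(1) x(3)[of j]] pairing x(2) by auto
    moreover have "bracket G (f k) (bracket G (e j) x) = 0" if "k \<notin> J" for k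
    proof -
      have "bracket G (f k) (e j) = 0"
        using br_antisym[of "f k" "e j"] bracket_e_f that j(1) by auto
      then show ?thesis using x(3)[of k] that by (simp add: br_derivation[of "f k"])
    qed
    ultimately show ?thesis
      by (intro conjI exI[of _ "j # w"] exI[of _ i] exI[of _ "bracket G (e j) x"]) simp_all
  qed
qed

lemma sum_simple_roots_nonzero: "J \<noteq> {} \<Longrightarrow> (\<Sum>i\<in>J. \<alpha> i) \<noteq> 0"
  using sum_simple_roots_inj[of J "{}"] by auto

lemma real_root_finite_type:
  assumes "connected_subdiagram A I" and "finite_type A I"
  shows "real_root G (\<Sum>i\<in>I. \<alpha> i)"
proof -
  note conn = connected_subdiagram_imp_cut_connected[OF assms(1)]
  obtain u :: "'i \<Rightarrow> real" where "\<forall>j\<in>I. u j > 0" "\<forall>i\<in>I. (\<Sum>j\<in>I. of_int (A i j) * u j) > 0"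
    using assms(2) unfolding finite_type_def by blast
  then have "(\<exists>w i. (\<Sum>i\<in>I. \<alpha> i) = foldr (reflection G) w (\<alpha> i)) \<and>
      (\<exists>x. x \<in> root_space G (\<Sum>i\<in>I. \<alpha> i) \<and> x \<noteq> 0 \<and> (\<forall>j. j \<notin> I \<longrightarrow> bracket G (f j) x = 0))"
    by (intro real_root_sum[OF subset_refl conn, of u]) simp_all
  moreover have "(\<Sum>i\<in>I. \<alpha> i) \<noteq> 0"
    using conn by (intro sum_simple_roots_nonzero) (simp add: cut_connected_def)
  ultimately show ?thesis
    unfolding real_root_def is_root_def using dual_space_sum[of I] by auto
qed

lemma real_root_simple: "real_root G (\<alpha> i)"
proof -
  have "\<alpha> i \<noteq> 0" using sum_simple_roots_nonzero[of "{i}"] by simp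
  moreover have "\<alpha> i = foldr (reflection G) [] (\<alpha> i)" by simp
  ultimately show ?thesis
    unfolding real_root_def is_root_def
    using simple_root_in_dual e_in_root_space e_nonzero by blast
qed

end

section \<open>Coroots and the invariant form\<close>

locale kac_moody_form = kac_moody A G
  for A :: "'i::finite \<Rightarrow> 'i \<Rightarrow> int"
    and G :: "('i, 'h::ab_group_add, 'g::ab_group_add) kac_moody_data" +
  fixes form :: "'g \<Rightarrow> 'g \<Rightarrow> complex"
  assumes form: "standard_invariant_form G form"
begin

definition bil :: "'h \<Rightarrow> 'h \<Rightarrow> complex" where
  "bil h h' = form (\<iota> h) (\<iota> h')"

lemma linear_form: "Vector_Spaces.linear (gscale G) (*) (form x)"
  and bil_sym: "bil h h' = bil h' h"
  and bil_eq_0: "\<forall>h'. bil h h' = 0 \<Longrightarrow> h = 0"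
  and ex_eps: "\<forall>i. \<exists>\<epsilon>::real. \<epsilon> > 0 \<and> (\<forall>h. bil (\<alpha>v i) h = of_real \<epsilon> * \<alpha> i h)"
proof -
  note form' = form[unfolded standard_invariant_form_def, folded bil_def]
  show "Vector_Spaces.linear (gscale G) (*) (form x)"
    by (rule form'[THEN conjunct1, THEN spec])
  show "bil h h' = bil h' h"
    unfolding bil_def by (rule form'[THEN conjunct2, THEN conjunct1, THEN spec, THEN spec])
  show "\<forall>h'. bil h h' = 0 \<Longrightarrow> h = 0"
    by (rule form'[THEN conjunct2, THEN conjunct2, THEN conjunct2, THEN conjunct1, rule_format]) simp
  show "\<forall>i. \<exists>\<epsilon>::real. \<epsilon> > 0 \<and> (\<forall>h. bil (\<alpha>v i) h = of_real \<epsilon> * \<alpha> i h)"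
    by (rule form'[THEN conjunct2, THEN conjunct2, THEN conjunct2, THEN conjunct2])
qed

lemma bil_diff_right: "bil h (t - t') = bil h t - bil h t'"
  and bil_scale_right: "bil h (hscale G c t) = c * bil h t"
proof -
  interpret l: Vector_Spaces.linear "gscale G" "(*)" "form (\<iota> h)" by (rule linear_form)
  show "bil h (t - t') = bil h t - bil h t'" "bil h (hscale G c t) = c * bil h t"
    by (simp_all only: bil_def incl_diff incl_scale l.diff l.scale)
qed

lemma bil_diff_left: "bil (t - t') h = bil t h - bil t' h"
  and bil_scale_left: "bil (hscale G c t) h = c * bil t h"
  by (simp_all only: bil_sym[of _ h] bil_diff_right bil_scale_right)

lemma bil_nondegenerate:
  assumes "\<And>h. bil t h = bil t' h"
  shows "t = t'"
proof -
  have "t - t' = 0" by (rule bil_eq_0) (simp add: bil_diff_left assms)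
  then show ?thesis by simp
qed

text \<open>Pairing a simple coroot with itself shows that \<open>eps i\<close> is half its squared
  length; in terms of roots it is 2 divided by the squared length of
  \<open>\<alpha> i\<close>.\<close>

definition eps :: "'i \<Rightarrow> real" where
  "eps = (SOME \<epsilon>. \<forall>i. \<epsilon> i > 0 \<and> (\<forall>h. bil (\<alpha>v i) h = of_real (\<epsilon> i) * \<alpha> i h))"

lemma eps_pos: "eps i > 0"
  and bil_simple_coroot: "bil (\<alpha>v i) h = of_real (eps i) * \<alpha> i h"
proof -
  have "\<exists>\<epsilon>. \<forall>i. \<epsilon> i > 0 \<and> (\<forall>h. bil (\<alpha>v i) h = of_real (\<epsilon> i) * \<alpha> i h)"
    by (rule choice[OF ex_eps])
  then have "\<forall>i. eps i > 0 \<and> (\<forall>h. bil (\<alpha>v i) h = of_real (eps i) * \<alpha> i h)"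
    unfolding eps_def by (rule someI_ex)
  then show "eps i > 0" "bil (\<alpha>v i) h = of_real (eps i) * \<alpha> i h" by auto
qed

text \<open>Both sides evaluate the form on the coroots of \<open>i\<close> and \<open>j\<close>, in
  the two orders.\<close>

lemma eps_symmetrizes: "complex_of_real (eps i) * of_int (A j i) = of_real (eps j) * of_int (A i j)"
  using bil_sym[of "\<alpha>v i" "\<alpha>v j"] by (simp only: bil_simple_coroot simple_root_coroot)

text \<open>The second property says that \<open>c\<close>, divided by \<open>eps i\<close>,
  represents \<open>b\<close> under the form. Together with the pairing 2 it determines coroots and
  lengths; integrality is needed for the row of the collapsed vertex.\<close>

lemma weyl_word:
  fixes w i
  defines "b \<equiv> foldr (reflection G) w (\<alpha> i)" and "c \<equiv> foldr (coreflection G) w (\<alpha>v i)"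
  shows weyl_word_dual: "b \<in> dual_space G"
    and weyl_word_bil: "bil c h = of_real (eps i) * b h"
    and weyl_word_pairing: "b c = 2"
    and weyl_word_integral: "\<alpha> k c \<in> \<int>"
proof -
  have "b \<in> dual_space G \<and> (\<forall>h. bil c h = of_real (eps i) * b h) \<and> b c = 2 \<and> (\<forall>k. \<alpha> k c \<in> \<int>)"
    unfolding b_def c_def
  proof (induction w)
    case Nil
    then show ?case
      by (simp add: simple_root_in_dual bil_simple_coroot simple_root_coroot diag)
  next
    case (Cons j w)
    let ?b = "foldr (reflection G) w (\<alpha> i)" and ?c = "foldr (coreflection G) w (\<alpha>v i)"
    have IH: "?b \<in> dual_space G" "\<And>h. bil ?c h = of_real (eps i) * ?b h" "?b ?c = 2"
      "\<And>k. \<alpha> k ?c \<in> \<int>" using Cons.IH by auto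
    \<comment> \<open>This matches the terms that the reflection and the coreflection by
      \<open>j\<close> subtract.\<close>
    have sym: "of_real (eps j) * \<alpha> j ?c = of_real (eps i) * ?b (\<alpha>v j)"
      using bil_simple_coroot[of j ?c] IH(2)[of "\<alpha>v j"] bil_sym[of "\<alpha>v j" ?c] by metis
    have "reflection G j ?b \<in> dual_space G"
      unfolding reflection_def[of G j ?b]
      by (intro dual_space_diff dual_space_scale IH simple_root_in_dual)
    moreover have "bil (coreflection G j ?c) h = of_real (eps i) * reflection G j ?b h" for h
      using arg_cong[OF sym[symmetric], of "\<lambda>x. x * \<alpha> j h"]
      by (simp add: coreflection_def reflection_def bil_diff_left bil_scale_left IH(2)
          bil_simple_coroot dual_scale_def algebra_simps)
    moreover have "reflection G j ?b (coreflection G j ?c) = 2"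
      by (simp add: coreflection_def reflection_def dual_scale_def dual_diff dual_scale' IH(1,3)
          simple_root_in_dual simple_root_coroot diag algebra_simps)
    moreover have "\<alpha> k (coreflection G j ?c) \<in> \<int>" for k
      using IH(4) by (simp add: coreflection_def dual_diff dual_scale' simple_root_in_dual
          simple_root_coroot)
    ultimately show ?case by simp
  qed
  then show "b \<in> dual_space G" "bil c h = of_real (eps i) * b h" "b c = 2" "\<alpha> k c \<in> \<int>" by auto
qed

text \<open>Two candidates represent positive multiples of the same \<beta>, so nondegeneracy makes
  them proportional. Both pair to 2 with \<beta>, so the ratio is 1.\<close>

lemma coroot_eq:
  assumes "\<beta> = foldr (reflection G) w (\<alpha> i)"
  shows "coroot G \<beta> = foldr (coreflection G) w (\<alpha>v i)"
  unfolding coroot_def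
proof (rule the_equality)
  show "\<exists>w' i'. \<beta> = foldr (reflection G) w' (\<alpha> i') \<and>
      foldr (coreflection G) w (\<alpha>v i) = foldr (coreflection G) w' (\<alpha>v i')"
    using assms by blast
next
  fix c' assume "\<exists>w i. \<beta> = foldr (reflection G) w (\<alpha> i) \<and> c' = foldr (coreflection G) w (\<alpha>v i)"
  then obtain v j where v: "\<beta> = foldr (reflection G) v (\<alpha> j)"
    and c': "c' = foldr (coreflection G) v (\<alpha>v j)" by blast
  let ?c = "foldr (coreflection G) w (\<alpha>v i)"
  note W = weyl_word[where w=w and i=i, folded assms] and V = weyl_word[where w=v and i=j, folded v c']
  let ?r = "complex_of_real (eps j / eps i)"
  have eq: "c' = hscale G ?r ?c"
    by (rule bil_nondegenerate)
      (use W(2) V(2) eps_pos[of i] in \<open>simp add: bil_scale_left\<close>)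
  then have "2 = ?r * 2"
    using W(1,3) V(3) by (metis dual_scale')
  then have "?r = 1" by (metis mult_1 mult_right_cancel zero_neq_numeral)
  then show "c' = ?c" using eq by (metis cartan.scale_one)
qed

text \<open>The vector representing \<beta> is its coroot divided by \<open>eps i\<close>, and
  \<beta> takes the value 2 on the coroot.\<close>

lemma dual_form_weyl_word:
  assumes "\<beta> = foldr (reflection G) w (\<alpha> i)"
  shows "dual_form G form \<beta> \<beta> = 2 / of_real (eps i)"
proof -
  let ?c = "foldr (coreflection G) w (\<alpha>v i)"
  let ?t = "hscale G (1 / of_real (eps i)) ?c"
  note W = weyl_word[where w=w and i=i, folded assms]
  have t: "bil ?t h = \<beta> h" for h
    using W(2) eps_pos[of i] by (simp add: bil_scale_left)
  have "form_dual G form \<beta> = ?t"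
    unfolding form_dual_def bil_def[symmetric]
  proof (rule the_equality)
    show "\<forall>h. bil ?t h = \<beta> h" by (intro allI t)
  next
    fix t' assume "\<forall>h. bil t' h = \<beta> h"
    then show "t' = ?t" by (intro bil_nondegenerate) (simp only: t)
  qed
  then have "dual_form G form \<beta> \<beta> = \<beta> ?t"
    by (simp only: dual_form_def bil_def[symmetric] t)
  also have "\<dots> = 2 / of_real (eps i)"
    using W(1,3) by (simp add: dual_scale')
  finally show ?thesis .
qed

lemma coroot_simple: "coroot G (\<alpha> i) = \<alpha>v i"
  using coroot_eq[of "\<alpha> i" "[]" i] by simp

lemma dual_form_simple: "dual_form G form (\<alpha> i) (\<alpha> i) = 2 / of_real (eps i)"
  using dual_form_weyl_word[of "\<alpha> i" "[]" i] by simp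

text \<open>The form between the coroots of \<open>\<alpha> j\<close> and \<beta> is computed from
  either side; \<open>eps_symmetrizes\<close> then transposes the matrix entries. The factor
  \<open>eps l / eps i\<close> is the ratio of the squared lengths of \<open>\<alpha> i\<close> and
  \<beta>.\<close>

lemma simple_root_coroot_sum:
  assumes \<beta>: "\<beta> = (\<Sum>i\<in>I. \<alpha> i)" and w: "\<beta> = foldr (reflection G) w (\<alpha> l)"
  shows "\<alpha> j (coroot G \<beta>) = (\<Sum>i\<in>I. of_real (eps l / eps i) * of_int (A i j))"
proof -
  have nz: "eps i \<noteq> 0" for i using eps_pos[of i] by simp
  have "of_real (eps j) * \<alpha> j (coroot G \<beta>) = bil (coroot G \<beta>) (\<alpha>v j)"
    by (simp only: bil_sym[of _ "\<alpha>v j"] bil_simple_coroot)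
  also have "\<dots> = of_real (eps l) * \<beta> (\<alpha>v j)"
    using coroot_eq[OF w] weyl_word_bil[where w=w and i=l, folded w] by simp
  also have "\<dots> = (\<Sum>i\<in>I. of_real (eps l) * of_int (A j i))"
    by (simp add: \<beta> sum_fun_apply simple_root_coroot sum_distrib_left)
  also have "\<dots> = (\<Sum>i\<in>I. of_real (eps j) * (of_real (eps l / eps i) * of_int (A i j)))"
  proof (rule sum.cong[OF refl])
    fix i
    show "complex_of_real (eps l) * of_int (A j i)
        = of_real (eps j) * (of_real (eps l / eps i) * of_int (A i j))"
      using eps_symmetrizes[of i j] nz[of i] by (simp add: field_simps)
  qed
  also have "\<dots> = of_real (eps j) * (\<Sum>i\<in>I. of_real (eps l / eps i) * of_int (A i j))"
    by (simp only: sum_distrib_left)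
  finally show ?thesis using nz[of j] by (simp only: mult_left_cancel of_real_eq_0_iff not_False_eq_True)
qed

end

section \<open>The collapsed family and its type\<close>

theorem mainTheorem5:
  fixes A :: "'i::finite \<Rightarrow> 'i \<Rightarrow> int"
    and G :: "('i, 'h::ab_group_add, 'g::ab_group_add) kac_moody_data"
    and form :: "'g \<Rightarrow> 'g \<Rightarrow> complex"
    and I :: "'i set"
  assumes "kac_moody_algebra A G"
    and "symmetrizable A"
    and "standard_invariant_form G form"
    and "connected_subdiagram A I"
    and "finite_type A I"
  shows "pi_system G (collapsed_index I) (collapsed_roots G I) \<and>
    generalized_cartan_matrix (collapsed_index I) (pi_system_type G (collapsed_roots G I)) \<and>
    (\<forall>j\<in>-I. \<forall>k\<in>-I. pi_system_type G (collapsed_roots G I) (Some j) (Some k) = of_int (A j k)) \<and>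
    (\<forall>j\<in>-I. pi_system_type G (collapsed_roots G I) (Some j) None = (\<Sum>i\<in>I. of_int (A j i))) \<and>
    (\<forall>j\<in>-I. pi_system_type G (collapsed_roots G I) None (Some j) =
       (\<Sum>i\<in>I. dual_form G form (simple_root G i) (simple_root G i)
               / dual_form G form (collapsed_roots G I None) (collapsed_roots G I None)
               * of_int (A i j)))"
proof -
  interpret kac_moody_form A G form
    using assms(1,3) by unfold_locales
  let ?\<beta> = "collapsed_roots G I" and ?K = "collapsed_index I"
  let ?B = "pi_system_type G ?\<beta>"
  \<comment> \<open>Every member of the family is the sum of the simple roots over its support. The
    supports are nonempty and pairwise disjoint, so the collapsed root and the simple roots are
    treated alike.\<close>
  define supp where "supp k = (case k of None \<Rightarrow> I | Some j \<Rightarrow> {j})" for k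
  have I: "I \<noteq> {}" using assms(4) by (simp add: connected_subdiagram_def)
  have supp: "?\<beta> k = (\<Sum>i\<in>supp k. \<alpha> i)" for k
    by (cases k) (auto simp: collapsed_roots_def supp_def)
  have ne: "supp k \<noteq> {}" for k using I by (cases k) (auto simp: supp_def)
  have disj: "supp k \<inter> supp l = {}" if "k \<in> ?K" "l \<in> ?K" "k \<noteq> l" for k l
    using that by (auto simp: collapsed_index_def supp_def split: option.splits)
  have root_None: "?\<beta> None = (\<Sum>i\<in>I. \<alpha> i)" and root_Some: "?\<beta> (Some j) = \<alpha> j" for j
    by (simp_all add: collapsed_roots_def)
  have real: "real_root G (?\<beta> k)" for k
    using real_root_finite_type[OF assms(4,5)] real_root_simple
    by (cases k) (simp_all add: root_None root_Some)
  have fin: "finite ?K" by (simp add: collapsed_index_def)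
  have pi: "pi_system G ?K ?\<beta>"
    unfolding pi_system_def
  proof (intro conjI ballI impI inj_onI fin real)
    show "k = l" if "k \<in> ?K" "l \<in> ?K" "?\<beta> k = ?\<beta> l" for k l
      using that supp sum_simple_roots_inj disj ne by (metis inf.idem)
    show "\<not> is_root G (?\<beta> k - ?\<beta> l)" if "k \<in> ?K" "l \<in> ?K" "k \<noteq> l" for k l
      unfolding supp by (rule not_root_diff_sums[OF disj[OF that] ne ne])
  qed
  obtain w l where w: "?\<beta> None = foldr (reflection G) w (\<alpha> l)"
    using real[of None] unfolding real_root_def by blast
  have nz: "eps i \<noteq> 0" for i using eps_pos[of i] by simp
  have SS: "?B (Some j) (Some k) = of_int (A j k)" for j k
    by (simp add: pi_system_type_def root_Some coroot_simple simple_root_coroot)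
  have SN: "?B (Some j) None = of_int (\<Sum>i\<in>I. A j i)" for j
    by (simp add: pi_system_type_def root_Some root_None coroot_simple simple_root_coroot
        sum_fun_apply)
  have NN: "?B None None = 2"
    unfolding pi_system_type_def using coroot_eq[OF w] weyl_word_pairing[where w=w and i=l, folded w] by simp
  have NS: "?B None (Some j) = (\<Sum>i\<in>I. of_real (eps l / eps i) * of_int (A i j))" for j
    unfolding pi_system_type_def root_Some by (rule simple_root_coroot_sum[OF root_None w])
  have k: "dual_form G form (\<alpha> i) (\<alpha> i) / dual_form G form (?\<beta> None) (?\<beta> None)
      = of_real (eps l / eps i)" for i
    unfolding dual_form_simple dual_form_weyl_word[OF w] using nz by simp
  have NS_re: "?B None (Some j) = of_real (\<Sum>i\<in>I. eps l / eps i * of_int (A i j))" for j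
    by (simp add: NS)
  have le: "A i j \<le> 0" if "i \<in> I" "j \<notin> I" for i j using off_diag that by metis
  have le': "A j i \<le> 0" if "i \<in> I" "j \<notin> I" for i j using off_diag that by metis
  \<comment> \<open>Integrality is not visible in the formula with length ratios, so it comes from
    the Weyl word; the formula gives the sign, compared over the reals.\<close>
  have NS_nonpos: "?B None (Some j) \<in> \<int>\<^sub>\<le>\<^sub>0" if "j \<notin> I" for j
  proof -
    have "?B None (Some j) \<in> \<int>"
      unfolding pi_system_type_def root_Some coroot_eq[OF w] by (rule weyl_word_integral)
    then obtain n where n: "?B None (Some j) = of_int n" by (rule Ints_cases)
    have "(\<Sum>i\<in>I. eps l / eps i * of_int (A i j)) \<le> 0"
      using le that eps_pos by (intro sum_nonpos mult_nonneg_nonpos) (auto simp: less_imp_le)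
    moreover have "complex_of_real (\<Sum>i\<in>I. eps l / eps i * of_int (A i j)) = of_real (of_int n)"
      using n NS_re[of j] by (simp only: of_real_of_int_eq)
    then have "(\<Sum>i\<in>I. eps l / eps i * of_int (A i j)) = of_int n"
      by (simp only: of_real_eq_iff)
    ultimately show ?thesis using n by (simp add: nonpos_Ints_of_int)
  qed
  \<comment> \<open>A sum of terms of one sign vanishes only if every term does. This reduces the
    symmetry of zeros in the type to that in \<open>A\<close>.\<close>
  have SN_zero: "?B (Some j) None = 0 \<longleftrightarrow> (\<forall>i\<in>I. A j i = 0)" if "j \<notin> I" for j
  proof -
    have "(\<Sum>i\<in>I. - A j i) = 0 \<longleftrightarrow> (\<forall>i\<in>I. - A j i = 0)"
      using le' that by (intro sum_nonneg_eq_0_iff) auto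
    then show ?thesis by (simp add: SN sum_negf flip: of_int_sum)
  qed
  have NS_zero: "?B None (Some j) = 0 \<longleftrightarrow> (\<forall>i\<in>I. A i j = 0)" if "j \<notin> I" for j
  proof -
    have "(\<Sum>i\<in>I. - (eps l / eps i * of_int (A i j))) = 0
        \<longleftrightarrow> (\<forall>i\<in>I. - (eps l / eps i * of_int (A i j)) = 0)"
    proof (rule sum_nonneg_eq_0_iff)
      show "0 \<le> - (eps l / eps i * of_int (A i j))" if "i \<in> I" for i
        using le[OF that \<open>j \<notin> I\<close>] eps_pos[of i] eps_pos[of l]
        by (simp add: mult_nonneg_nonpos divide_nonpos_pos)
    qed simp
    then show ?thesis unfolding NS_re of_real_eq_0_iff sum_negf by (simp add: nz)
  qed
  have gcm: "generalized_cartan_matrix ?K ?B"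
    unfolding generalized_cartan_matrix_def
  proof (intro conjI ballI impI fin)
    fix k show "?B k k = 2" by (cases k) (simp_all add: NN SS diag)
  next
    fix k m assume km: "k \<in> ?K" "m \<in> ?K" "k \<noteq> m"
    show "?B k m \<in> \<int>\<^sub>\<le>\<^sub>0"
    proof (cases k; cases m)
      fix j assume "k = Some j" "m = None"
      moreover from this have "(\<Sum>i\<in>I. A j i) \<le> 0"
        using km le' by (intro sum_nonpos) (auto simp: collapsed_index_def)
      ultimately show ?thesis by (simp only: SN nonpos_Ints_of_int)
    qed (use km NS_nonpos off_diag in \<open>auto simp: collapsed_index_def SS nonpos_Ints_of_int\<close>)
  next
    fix k m assume km: "k \<in> ?K" "m \<in> ?K" "?B k m = 0"
    then show "?B m k = 0"
      using SN_zero NS_zero zero_sym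
      by (cases k; cases m) (auto simp: collapsed_index_def SS)
  qed
  show ?thesis
    using pi gcm by (simp add: SS SN NS k)
qed

end
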